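(* Let $\mathcal{M}$ be a unitary magma without nontrivial unit divisors. Then the space $\mathsf{Acy}\mathcal{M}=\mathsf{C}\mathcal{M}/\mathfrak{R}_{\mathsf{Acy}\mathcal{M}}$ is a quotient operad of $\mathsf{C}\mathcal{M}$ (that is, $\mathfrak{R}_{\mathsf{Acy}\mathcal{M}}$ is an operad ideal of $\mathsf{C}\mathcal{M}$).
   Context: Let $\mathbb{K}$ be a field of characteristic zero and $[n]=\{1,\dots,n\}$. A unitary magma is a set $\mathcal{M}$ with a binary operation $\star$ (not assumed associative) having a two-sided unit $\mathbb{1}_{\mathcal{M}}$. It is without nontrivial unit divisors if $a\star b=\mathbb{1}_{\mathcal{M}}$ implies $a=b=\mathbb{1}_{\mathcal{M}}$. Operads are nonsymmetric operads in $\mathbb{K}$-vector spaces (graded from arity $1$, with partial compositions $\circ_i$ and a unit of arity $1$). An operad ideal of $\mathcal{O}$ is a graded subspace $I$ such that $x\circ_i y$ and $y\circ_j x$ are in $I$ for all $x\in\mathcal{O}$, $y\in I$ and valid $i,j$; then $\mathcal{O}/I$ is a quotient operad. An $\mathcal{M}$-clique of arity $n\ge1$ is a map $\mathfrak{p}$ assigning a label $\mathfrak{p}(x,y)\in\mathcal{M}$ to each arc $(x,y)$, $1\le x<y\le n+1$; by convention the only $\mathcal{M}$-clique of arity $1$ is $\mathbf{u}$, with $\mathbf{u}(1,2)=\mathbb{1}_{\mathcal{M}}$. An arc is solid if its label is not $\mathbb{1}_{\mathcal{M}}$. Write $\mathfrak{p}_0:=\mathfrak{p}(1,n+1)$ and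 $\mathfrak{p}_i:=\mathfrak{p}(i,i+1)$ for $i\in[n]$. $\mathsf{C}\mathcal{M}$ is the operad (with unit $\mathbf{u}$) such that $\mathsf{C}\mathcal{M}(n)$ has basis the $\mathcal{M}$-cliques of arity $n$, and for $\mathcal{M}$-cliques $\mathfrak{p},\mathfrak{q}$ of arities $n,m$ and $i\in[n]$, $\mathfrak{p}\circ_i\mathfrak{q}$ is the $\mathcal{M}$-clique of arity $n+m-1$ with, for $1\le x<y\le n+m$, $$(\mathfrak{p}\circ_i\mathfrak{q})(x,y)=\begin{cases}\mathfrak{p}(x,y)&\text{if }y\le i,\\ \mathfrak{p}(x,y-m+1)&\text{if }x\le i<i+m\le y,\ (x,y)\ne(i,i+m),\\ \mathfrak{p}(x-m+1,y-m+1)&\text{if }i+m\le x,\\ \mathfrak{q}(x-i+1,y-i+1)&\text{if }i\le x<y\le i+m,\ (x,y)\ne(i,i+m),\\ \mathfrak{p}_i\star\mathfrak{q}_0&\text{if }(x,y)=(i,i+m),\\ \mathbb{1}_{\mathcal{M}}&\text{otherwise}.\end{cases}$$ The skeleton of an $\mathcal{M}$-clique $\mathfrak{p}$ of arity $n$ is the undirected graph on $[n+1]$ with an edge $\{x,y\}$ for each solid arc $(x,y)$ of $\mathfrak{p}$; $\mathfrak{p}$ is acyclic if its skeleton has no cycle (i.e. is a forest). $\mathfrak{R}_{\mathsf{Acy}\mathcal{M}}$ is the subspace of $\mathsf{C}\mathcal{M}$ spanned by all $\mathcal{M}$-cliques that are not acyclic. *)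

theory Defs
  imports Complex_Main "HOL-Library.Poly_Mapping" "HOL-Library.FuncSet"
begin

text \<open>
  A nonsymmetric operad in vector spaces, graded from arity 1. The homogeneous
  components \<open>Op n\<close> are subspaces of one ambient space but need not intersect
  trivially: the grading is external, so the arities of the two arguments are
  parameters of the partial composition \<open>cmp n m i : Op n \<times> Op m \<rightarrow> Op (n + m - 1)\<close>.
  \<open>Op 0\<close> carries no meaning.
\<close>

locale ns_operad = vector_space scale
  for scale :: "'k::field \<Rightarrow> 'v::ab_group_add \<Rightarrow> 'v" +
  fixes Op :: "nat \<Rightarrow> 'v set"
    and cmp :: "nat \<Rightarrow> nat \<Rightarrow> nat \<Rightarrow> 'v \<Rightarrow> 'v \<Rightarrow> 'v"
    and un :: 'v
  assumes Op_subspace: "1 \<le> n \<Longrightarrow> subspace (Op n)"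
    and un_closed: "un \<in> Op 1"
    and cmp_closed:
      "\<lbrakk>1 \<le> n; 1 \<le> m; i \<in> {1..n}; x \<in> Op n; y \<in> Op m\<rbrakk>
        \<Longrightarrow> cmp n m i x y \<in> Op (n + m - 1)"
    and cmp_add_left:
      "\<lbrakk>1 \<le> n; 1 \<le> m; i \<in> {1..n}; x \<in> Op n; x' \<in> Op n; y \<in> Op m\<rbrakk>
        \<Longrightarrow> cmp n m i (x + x') y = cmp n m i x y + cmp n m i x' y"
    and cmp_add_right:
      "\<lbrakk>1 \<le> n; 1 \<le> m; i \<in> {1..n}; x \<in> Op n; y \<in> Op m; y' \<in> Op m\<rbrakk>
        \<Longrightarrow> cmp n m i x (y + y') = cmp n m i x y + cmp n m i x y'"
    and cmp_scale_left:
      "\<lbrakk>1 \<le> n; 1 \<le> m; i \<in> {1..n}; x \<in> Op n; y \<in> Op m\<rbrakk>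
        \<Longrightarrow> cmp n m i (scale c x) y = scale c (cmp n m i x y)"
    and cmp_scale_right:
      "\<lbrakk>1 \<le> n; 1 \<le> m; i \<in> {1..n}; x \<in> Op n; y \<in> Op m\<rbrakk>
        \<Longrightarrow> cmp n m i x (scale c y) = scale c (cmp n m i x y)"
    and cmp_sequential:
      "\<lbrakk>1 \<le> n; 1 \<le> m; 1 \<le> k; i \<in> {1..n}; j \<in> {1..m}; x \<in> Op n; y \<in> Op m; z \<in> Op k\<rbrakk>
        \<Longrightarrow> cmp (n + m - 1) k (i + j - 1) (cmp n m i x y) z
          = cmp n (m + k - 1) i x (cmp m k j y z)"
    and cmp_parallel:
      "\<lbrakk>1 \<le> n; 1 \<le> m; 1 \<le> k; i \<in> {1..n}; j \<in> {1..n}; i < j; x \<in> Op n; y \<in> Op m; z \<in> Op k\<rbrakk>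
        \<Longrightarrow> cmp (n + m - 1) k (j + m - 1) (cmp n m i x y) z
          = cmp (n + k - 1) m i (cmp n k j x z) y"
    and un_left: "\<lbrakk>1 \<le> n; x \<in> Op n\<rbrakk> \<Longrightarrow> cmp 1 n 1 un x = x"
    and un_right: "\<lbrakk>1 \<le> n; i \<in> {1..n}; x \<in> Op n\<rbrakk> \<Longrightarrow> cmp n 1 i x un = x"

locale operad_ideal = ns_operad scale Op cmp un
  for scale :: "'k::field \<Rightarrow> 'v::ab_group_add \<Rightarrow> 'v"
    and Op :: "nat \<Rightarrow> 'v set"
    and cmp :: "nat \<Rightarrow> nat \<Rightarrow> nat \<Rightarrow> 'v \<Rightarrow> 'v \<Rightarrow> 'v"
    and un :: 'v +
  fixes I :: "nat \<Rightarrow> 'v set"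
  assumes ideal_subspace: "1 \<le> n \<Longrightarrow> subspace (I n)"
    and ideal_subset: "1 \<le> n \<Longrightarrow> I n \<subseteq> Op n"
    and ideal_cmp_right:
      "\<lbrakk>1 \<le> n; 1 \<le> m; i \<in> {1..n}; x \<in> Op n; y \<in> I m\<rbrakk>
        \<Longrightarrow> cmp n m i x y \<in> I (n + m - 1)"
    and ideal_cmp_left:
      "\<lbrakk>1 \<le> n; 1 \<le> m; j \<in> {1..m}; x \<in> Op n; y \<in> I m\<rbrakk>
        \<Longrightarrow> cmp m n j y x \<in> I (n + m - 1)"

locale unitary_magma =
  fixes star :: "'m \<Rightarrow> 'm \<Rightarrow> 'm" (infixl "\<star>" 70)
    and one :: 'm ("\<one>")
  assumes one_left: "\<one> \<star> a = a"
    and one_right: "a \<star> \<one> = a"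

definition no_nontrivial_unit_divisors :: "('m \<Rightarrow> 'm \<Rightarrow> 'm) \<Rightarrow> 'm \<Rightarrow> bool" where
  "no_nontrivial_unit_divisors star one \<longleftrightarrow>
    (\<forall>a b. star a b = one \<longrightarrow> a = one \<and> b = one)"

definition arcs :: "nat \<Rightarrow> (nat \<times> nat) set" where
  "arcs n = {(x, y). 1 \<le> x \<and> x < y \<and> y \<le> n + 1}"

text \<open>Labellings are \<open>undefined\<close> off the arcs, so that a clique of given arity is
  determined by its labels.\<close>

type_synonym 'm clique = "nat \<times> nat \<Rightarrow> 'm"

definition unit_clique :: "'m \<Rightarrow> 'm clique" where
  "unit_clique one = (\<lambda>a\<in>arcs 1. one)"

definition cliques :: "'m \<Rightarrow> nat \<Rightarrow> 'm clique set" where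
  "cliques one n = (if n = 1 then {unit_clique one} else arcs n \<rightarrow>\<^sub>E UNIV)"

text \<open>For \<open>m \<ge> 1\<close> the cases below are mutually exclusive, and every subtraction is exact
  in the case where it is used.\<close>

definition clique_comp ::
    "('m \<Rightarrow> 'm \<Rightarrow> 'm) \<Rightarrow> 'm \<Rightarrow> nat \<Rightarrow> nat \<Rightarrow> nat \<Rightarrow> 'm clique \<Rightarrow> 'm clique \<Rightarrow> 'm clique" where
  "clique_comp star one n m i p q = (\<lambda>(x, y)\<in>arcs (n + m - 1).
    if y \<le> i then p (x, y)
    else if x \<le> i \<and> i + m \<le> y \<and> (x, y) \<noteq> (i, i + m) then p (x, y - m + 1)
    else if i + m \<le> x then p (x - m + 1, y - m + 1)
    else if i \<le> x \<and> y \<le> i + m \<and> (x, y) \<noteq> (i, i + m) then q (x - i + 1, y - i + 1)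
    else if (x, y) = (i, i + m) then star (p (i, i + 1)) (q (1, m + 1))
    else one)"

text \<open>\<open>C n\<close> is the space of formal linear combinations of cliques of arity \<open>n\<close>.\<close>

definition lc_scale :: "'k::field \<Rightarrow> ('a \<Rightarrow>\<^sub>0 'k) \<Rightarrow> ('a \<Rightarrow>\<^sub>0 'k)" where
  "lc_scale c = Poly_Mapping.map ((*) c)"

definition C_space :: "'m \<Rightarrow> nat \<Rightarrow> ('m clique \<Rightarrow>\<^sub>0 'k::field) set" where
  "C_space one n = {v. Poly_Mapping.keys v \<subseteq> cliques one n}"

definition C_comp ::
    "('m \<Rightarrow> 'm \<Rightarrow> 'm) \<Rightarrow> 'm \<Rightarrow> nat \<Rightarrow> nat \<Rightarrow> nat
      \<Rightarrow> ('m clique \<Rightarrow>\<^sub>0 'k::field) \<Rightarrow> ('m clique \<Rightarrow>\<^sub>0 'k) \<Rightarrow> ('m clique \<Rightarrow>\<^sub>0 'k)" where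
  "C_comp star one n m i v w =
    (\<Sum>p\<in>Poly_Mapping.keys v. \<Sum>q\<in>Poly_Mapping.keys w.
      Poly_Mapping.single (clique_comp star one n m i p q)
        (Poly_Mapping.lookup v p * Poly_Mapping.lookup w q))"

definition C_unit :: "'m \<Rightarrow> ('m clique \<Rightarrow>\<^sub>0 'k::field)" where
  "C_unit one = Poly_Mapping.single (unit_clique one) 1"

text \<open>A simple undirected graph is a pair of a vertex set and a set of two-element edges;
  a cycle is given by its cyclic list of at least three distinct vertices.\<close>

definition is_graph_cycle :: "'a set \<times> 'a set set \<Rightarrow> 'a list \<Rightarrow> bool" where
  "is_graph_cycle G vs \<longleftrightarrow>
    set vs \<subseteq> fst G \<and> 3 \<le> length vs \<and> distinct vs \<and>
    (\<forall>j<length vs. {vs ! j, vs ! (Suc j mod length vs)} \<in> snd G)"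

definition skeleton :: "'m \<Rightarrow> nat \<Rightarrow> 'm clique \<Rightarrow> nat set \<times> nat set set" where
  "skeleton one n p = ({1..n + 1}, {{x, y} | x y. (x, y) \<in> arcs n \<and> p (x, y) \<noteq> one})"

definition acyclic_clique :: "'m \<Rightarrow> nat \<Rightarrow> 'm clique \<Rightarrow> bool" where
  "acyclic_clique one n p \<longleftrightarrow> (\<nexists>vs. is_graph_cycle (skeleton one n p) vs)"

definition R_Acy :: "'m \<Rightarrow> nat \<Rightarrow> ('m clique \<Rightarrow>\<^sub>0 'k::field) set" where
  "R_Acy one n = module.span lc_scale
    ((\<lambda>p. Poly_Mapping.single p 1) ` {p \<in> cliques one n. \<not> acyclic_clique one n p})"

end

theory Submission
  imports Defs
begin

text \<open>
  The composition \<open>p \<circ>\<^sub>i q\<close> glues the base of \<open>q\<close> onto the \<open>i\<close>-th edge of \<open>p\<close>. Every arc of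
  the result is therefore exactly one of the following: the image of an arc of \<open>p\<close> other than
  the \<open>i\<close>-th edge, the image of an arc of \<open>q\<close> other than the base, the gluing arc, labelled by
  a product, or an arc crossing the gluing arc, labelled by the unit
  (\<open>clique_comp_arc_cases\<close>). Running through these possibilities for both sides of the
  sequential and parallel laws proves them on cliques. The sequential law involves a product of
  three labels only when the middle clique has arity 1; that clique is then the unit clique, so
  the middle factor is the unit and no associativity of the magma is needed. The laws extend to
  linear combinations by bilinearity, which gives the operad \<open>ns_operad_C\<close>.

  For the ideal property, both \<open>p\<close> and \<open>q\<close> embed into \<open>p \<circ>\<^sub>i q\<close> by increasing maps of vertices.
  These maps send solid arcs to solid arcs: the label of an arc is either unchanged or replaced
  by a product in which it is a factor, and such a product is not the unit because there are no
  nontrivial unit divisors. Hence a cycle in the skeleton of \<open>p\<close> or of \<open>q\<close> yields one in that of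
  \<open>p \<circ>\<^sub>i q\<close> (\<open>not_acyclic_clique_comp_left\<close>, \<open>not_acyclic_clique_comp_right\<close>). As the span of a
  set of basis vectors consists of the vectors supported on that set, this is enough.
\<close>

section \<open>Arcs of a composition of cliques\<close>

text \<open>The position in \<open>p \<circ>\<^sub>i q\<close>, for \<open>q\<close> of arity \<open>m\<close>, of the vertex \<open>x\<close> of the outer clique \<open>p\<close>.
  The vertex \<open>x\<close> of the inner clique \<open>q\<close> goes to \<open>x + i - 1\<close>.\<close>

definition outer_pos :: "nat \<Rightarrow> nat \<Rightarrow> nat \<Rightarrow> nat" where
  "outer_pos i m x = (if x \<le> i then x else x + m - 1)"

lemma clique_comp_outer:
  assumes "1 \<le> m" "1 \<le> a" "a < b" "b \<le> n + 1" "(a, b) \<noteq> (i, i + 1)"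
    and xy: "x = outer_pos i m a" "y = outer_pos i m b"
  shows "clique_comp star one n m i p q (x, y) = p (a, b)"
proof -
  obtain m' where m: "m = Suc m'" using assms by (cases m) auto
  consider "b \<le> i" | "a \<le> i" "i < b" | "i < a" by linarith
  then show ?thesis
  proof cases
    case 1
    then show ?thesis using assms by (simp add: clique_comp_def arcs_def outer_pos_def)
  next
    case 2
    then have "(a, b + m') \<noteq> (i, i + m)" using assms m by auto
    with 2 show ?thesis
      unfolding xy using assms m by (simp add: clique_comp_def arcs_def outer_pos_def)
  next
    case 3
    then show ?thesis
      unfolding xy using assms m by (simp add: clique_comp_def arcs_def outer_pos_def)
  qed
qed

lemma clique_comp_inner:
  assumes "1 \<le> i" "i \<le> n" "1 \<le> a" "a < b" "b \<le> m + 1" "(a, b) \<noteq> (1, m + 1)"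
    and xy: "x = a + i - 1" "y = b + i - 1"
  shows "clique_comp star one n m i p q (x, y) = q (a, b)"
proof -
  obtain i' a' b' where "i = Suc i'" "a = Suc a'" "b = Suc b'"
    using assms by (cases i; cases a; cases b) auto
  then show ?thesis
    unfolding xy using assms by (simp add: clique_comp_def arcs_def) auto
qed

lemma clique_comp_base:
  assumes "1 \<le> i" "i \<le> n" "1 \<le> m" "y = i + m"
  shows "clique_comp star one n m i p q (i, y) = star (p (i, i + 1)) (q (1, m + 1))"
  using assms by (auto simp: clique_comp_def arcs_def)

lemma clique_comp_crossing:
  assumes "1 \<le> x" "y \<le> n + m" "x < i \<and> i < y \<and> y < i + m \<or> i < x \<and> x < i + m \<and> i + m < y"
  shows "clique_comp star one n m i p q (x, y) = one"
  using assms(3)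
proof
  assume "x < i \<and> i < y \<and> y < i + m"
  then show ?thesis using assms(1,2) by (simp add: clique_comp_def arcs_def)
next
  assume "i < x \<and> x < i + m \<and> i + m < y"
  then show ?thesis using assms(1,2) by (simp add: clique_comp_def arcs_def)
qed

text \<open>The four kinds of arcs of a composition. In the case \<open>crossing\<close> the arc crosses the gluing
  arc \<open>(i, i + m)\<close>.\<close>

lemma clique_comp_arc_cases:
  assumes "1 \<le> i" "i \<le> n" "1 \<le> m" "1 \<le> x" "x < y" "y \<le> n + m"
  obtains (outer) a b where "1 \<le> a" "a < b" "b \<le> n + 1" "(a, b) \<noteq> (i, i + 1)"
      "x = outer_pos i m a" "y = outer_pos i m b"
  | (inner) a b where "1 \<le> a" "a < b" "b \<le> m + 1" "(a, b) \<noteq> (1, m + 1)"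
      "x = a + i - 1" "y = b + i - 1"
  | (base) "x = i" "y = i + m"
  | (crossing) "x < i \<and> i < y \<and> y < i + m \<or> i < x \<and> x < i + m \<and> i + m < y"
proof -
  consider (l) "y \<le> i" | (o) "x \<le> i" "i + m \<le> y" "(x, y) \<noteq> (i, i + m)" | (r) "i + m \<le> x"
    | (i) "i \<le> x" "y \<le> i + m" "(x, y) \<noteq> (i, i + m)" | (b) "x = i" "y = i + m"
    | (c) "x < i \<and> i < y \<and> y < i + m \<or> i < x \<and> x < i + m \<and> i + m < y"
    using assms(5) by atomize_elim auto
  then show thesis
  proof cases
    case l
    then show ?thesis using assms by (intro outer[of x y]) (auto simp: outer_pos_def)
  next
    case o
    then show ?thesis using assms by (intro outer[of x "y - m + 1"]) (auto simp: outer_pos_def)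
  next
    case r
    then show ?thesis using assms
      by (intro outer[of "x - m + 1" "y - m + 1"]) (auto simp: outer_pos_def)
  next
    case i
    then show ?thesis using assms by (intro inner[of "x - i + 1" "y - i + 1"]) auto
  next
    case b
    then show ?thesis by (rule base)
  next
    case c
    then show ?thesis by (rule crossing)
  qed
qed

lemma clique_comp_extensional: "clique_comp star one n m i p q \<in> extensional (arcs (n + m - 1))"
  unfolding clique_comp_def by (rule restrict_extensional)

text \<open>Associativity of labels is only used when \<open>m = 1\<close>: otherwise the base of \<open>q\<close> and its \<open>j\<close>-th
  edge are distinct arcs, and no arc carries a product of three labels.\<close>

lemma clique_comp_sequential:
  assumes i: "1 \<le> i" "i \<le> n" and j: "1 \<le> j" "j \<le> m" and k: "1 \<le> k"
    and assoc: "m = 1 \<Longrightarrow> star (star (p (i, i + 1)) (q (1, 2))) (r (1, k + 1))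
      = star (p (i, i + 1)) (star (q (1, 2)) (r (1, k + 1)))"
  shows "clique_comp star one (n + m - 1) k (i + j - 1) (clique_comp star one n m i p q) r
       = clique_comp star one n (m + k - 1) i p (clique_comp star one m k j q r)"
    (is "?L = ?R")
proof (rule extensionalityI[where A = "arcs (n + m + k - 2)"])
  \<comment> \<open>Successor forms let the simplifier cancel the subtractions of 1 in the positions.\<close>
  obtain i' j' k' m' where [simp]: "i = Suc i'" "j = Suc j'" "k = Suc k'" "m = Suc m'"
    using assms by (metis Suc_le_D le_trans less_imp_le_nat One_nat_def)
  show "?L \<in> extensional (arcs (n + m + k - 2))"
    using clique_comp_extensional[of star one "n + m - 1" k] i j k by (simp add: numeral_2_eq_2)
  show "?R \<in> extensional (arcs (n + m + k - 2))"
    using clique_comp_extensional[of star one n "m + k - 1"] i j k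
    by (simp add: numeral_2_eq_2 add.assoc)
  let ?pq = "clique_comp star one n m i p q" and ?qr = "clique_comp star one m k j q r"
  fix z assume "z \<in> arcs (n + m + k - 2)"
  then obtain x y where z: "z = (x, y)" and xy: "1 \<le> x" "x < y" "y \<le> n + m + k - 1"
    using i j k by (auto simp: arcs_def)
  have y': "y \<le> (n + m - 1) + k" and ij: "1 \<le> i + j - 1" "i + j - 1 \<le> n + m - 1"
    and m: "1 \<le> m" and mk: "1 \<le> m + k - 1"
    using xy i j k by auto
  from ij k xy(1,2) y' have "?L (x, y) = ?R (x, y)"
  proof (cases rule: clique_comp_arc_cases)
    case (outer a b)
    have L: "?L (x, y) = ?pq (a, b)"
      using outer k by (intro clique_comp_outer) auto
    have "b \<le> n + m" using outer m by linarith
    with i m outer(1,2) show ?thesis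
    proof (cases rule: clique_comp_arc_cases)
      case (outer a' b')
      have "?pq (a, b) = p (a', b')"
        using outer m by (intro clique_comp_outer) auto
      moreover have "?R (x, y) = p (a', b')"
        using outer mk j k \<open>x = outer_pos _ _ a\<close> \<open>y = outer_pos _ _ b\<close>
        by (intro clique_comp_outer) (auto simp: outer_pos_def)
      ultimately show ?thesis using L by simp
    next
      case (inner a' b')
      have ne: "(a', b') \<noteq> (j, j + 1)"
        using inner \<open>(a, b) \<noteq> (i + j - 1, i + j - 1 + 1)\<close> i j by auto
      have "?pq (a, b) = q (a', b')"
        using inner i by (intro clique_comp_inner) auto
      moreover have "?R (x, y) = ?qr (outer_pos j k a', outer_pos j k b')"
        using inner i j k ne \<open>x = outer_pos _ _ a\<close> \<open>y = outer_pos _ _ b\<close>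
        by (intro clique_comp_inner) (auto simp: outer_pos_def split: if_splits)
      moreover have "\<dots> = q (a', b')"
        using inner k ne by (intro clique_comp_outer) auto
      ultimately show ?thesis using L by simp
    next
      case base
      have m2: "m \<noteq> 1" using base \<open>(a, b) \<noteq> (i + j - 1, i + j - 1 + 1)\<close> i j by auto
      have "?pq (a, b) = star (p (i, i + 1)) (q (1, m + 1))"
        unfolding base using i m by (intro clique_comp_base) auto
      moreover have "x = i" "y = i + (m + k - 1)"
        using base i j k \<open>x = outer_pos _ _ a\<close> \<open>y = outer_pos _ _ b\<close>
        by (auto simp: outer_pos_def split: if_splits)
      then have "?R (x, y) = star (p (i, i + 1)) (?qr (1, m + k - 1 + 1))"
        using i mk by (simp add: clique_comp_base)
      moreover have "?qr (1, m + k - 1 + 1) = q (1, m + 1)"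
        using m m2 j k by (intro clique_comp_outer) (auto simp: outer_pos_def)
      ultimately show ?thesis using L by simp
    next
      case crossing
      have "?pq (a, b) = one"
        using crossing outer \<open>b \<le> n + m\<close> by (intro clique_comp_crossing) auto
      moreover have "?R (x, y) = one"
        using crossing outer i j k xy by (intro clique_comp_crossing) (auto simp: outer_pos_def)
      ultimately show ?thesis using L by simp
    qed
  next
    case (inner a b)
    have "?L (x, y) = r (a, b)"
      using inner ij by (intro clique_comp_inner) auto
    moreover have "?R (x, y) = ?qr (a + j - 1, b + j - 1)"
      using inner i j k by (intro clique_comp_inner) auto
    moreover have "\<dots> = r (a, b)"
      using inner j by (intro clique_comp_inner) auto
    ultimately show ?thesis by simp
  next
    case base
    have L: "?L (x, y) = star (?pq (i + j - 1, i + j - 1 + 1)) (r (1, k + 1))"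
      unfolding base using ij k by (intro clique_comp_base) auto
    have qr: "?qr (j, j + k) = star (q (j, j + 1)) (r (1, k + 1))"
      using j k by (intro clique_comp_base) auto
    show ?thesis
    proof (cases "m = 1")
      case True
      \<comment> \<open>The base of \<open>q\<close> is its only edge, and \<open>(x, y)\<close> is the gluing arc of both compositions.\<close>
      then have "j = 1" using j by simp
      have "?pq (i, i + 1) = star (p (i, i + 1)) (q (1, 2))"
        using clique_comp_base[of i n m "i + 1" star one p q] i True
        by (simp add: numeral_2_eq_2)
      moreover have "?R (x, y) = star (p (i, i + 1)) (?qr (1, m + k - 1 + 1))"
        unfolding base \<open>j = 1\<close> using i mk True clique_comp_base[of i n "m + k - 1" "i + k"] by simp
      ultimately show ?thesis using L qr assoc True \<open>j = 1\<close> by (simp add: numeral_2_eq_2)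
    next
      case False
      have "?pq (i + j - 1, i + j - 1 + 1) = q (j, j + 1)"
        using i j False by (intro clique_comp_inner) auto
      moreover have "?R (x, y) = ?qr (j, j + k)"
        unfolding base using i j k False by (intro clique_comp_inner) auto
      ultimately show ?thesis using L qr by simp
    qed
  next
    case crossing
    have "?L (x, y) = one"
      using crossing xy y' by (intro clique_comp_crossing) auto
    moreover have "?R (x, y) = one"
    \<comment> \<open>On the right, the arc lies inside the image of \<open>q \<circ>\<^sub>j r\<close> or crosses the outer gluing arc.\<close>
    proof (cases "i \<le> x \<and> y \<le> i + m + k - 1")
      case True
      have "?R (x, y) = ?qr (x - i + 1, y - i + 1)"
        using crossing True i j k xy by (intro clique_comp_inner) auto
      also have "\<dots> = one"
        using crossing True i j k xy by (intro clique_comp_crossing) auto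
      finally show ?thesis .
    next
      case False
      then show ?thesis
        using crossing i j k xy by (intro clique_comp_crossing) auto
    qed
    ultimately show ?thesis by simp
  qed
  then show "?L z = ?R z" by (simp add: z)
qed

lemma clique_comp_parallel:
  assumes i: "1 \<le> i" "i < j" "j \<le> n" and m: "1 \<le> m" and k: "1 \<le> k"
  shows "clique_comp star one (n + m - 1) k (j + m - 1) (clique_comp star one n m i p q) r
       = clique_comp star one (n + k - 1) m i (clique_comp star one n k j p r) q"
    (is "?L = ?R")
proof (rule extensionalityI[where A = "arcs (n + m + k - 2)"])
  \<comment> \<open>Successor forms let the simplifier cancel the subtractions of 1 in the positions.\<close>
  obtain i' j' k' m' where [simp]: "i = Suc i'" "j = Suc j'" "k = Suc k'" "m = Suc m'"
    using assms by (metis Suc_le_D le_trans less_imp_le_nat One_nat_def)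
  show "?L \<in> extensional (arcs (n + m + k - 2))"
    using clique_comp_extensional[of star one "n + m - 1" k] i m k by (simp add: numeral_2_eq_2)
  show "?R \<in> extensional (arcs (n + m + k - 2))"
    using clique_comp_extensional[of star one "n + k - 1" m] i m k
    by (simp add: numeral_2_eq_2 add_ac)
  let ?pq = "clique_comp star one n m i p q" and ?pr = "clique_comp star one n k j p r"
  fix z assume "z \<in> arcs (n + m + k - 2)"
  then obtain x y where z: "z = (x, y)" and xy: "1 \<le> x" "x < y" "y \<le> n + m + k - 1"
    using i m k by (auto simp: arcs_def)
  have y': "y \<le> (n + m - 1) + k" and jm: "1 \<le> j + m - 1" "j + m - 1 \<le> n + m - 1"
    and ni: "i \<le> n" "i \<le> n + k - 1" and j: "1 \<le> j"
    using xy i m k by auto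
  from jm k xy(1,2) y' have "?L (x, y) = ?R (x, y)"
  proof (cases rule: clique_comp_arc_cases)
    case (outer a b)
    have L: "?L (x, y) = ?pq (a, b)"
      using outer k by (intro clique_comp_outer) auto
    have "b \<le> n + m" using outer m by linarith
    with i(1) ni(1) m outer(1,2) show ?thesis
    proof (cases rule: clique_comp_arc_cases)
      case (outer a' b')
      have ne: "(a', b') \<noteq> (j, j + 1)"
        using outer \<open>(a, b) \<noteq> (j + m - 1, j + m - 1 + 1)\<close> i m by (auto simp: outer_pos_def)
      have "?pq (a, b) = p (a', b')"
        using outer m by (intro clique_comp_outer) auto
      moreover have "?R (x, y) = ?pr (outer_pos j k a', outer_pos j k b')"
        using outer i m k \<open>x = outer_pos _ _ a\<close> \<open>y = outer_pos _ _ b\<close>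
        by (intro clique_comp_outer) (auto simp: outer_pos_def split: if_splits)
      moreover have "\<dots> = p (a', b')"
        using outer k ne by (intro clique_comp_outer) auto
      ultimately show ?thesis using L by simp
    next
      case (inner a' b')
      have "?pq (a, b) = q (a', b')"
        using inner i ni by (intro clique_comp_inner) auto
      moreover have "?R (x, y) = q (a', b')"
        using inner i m k \<open>x = outer_pos _ _ a\<close> \<open>y = outer_pos _ _ b\<close>
        by (intro clique_comp_inner) (auto simp: outer_pos_def)
      ultimately show ?thesis using L by simp
    next
      case base
      have "?pq (a, b) = star (p (i, i + 1)) (q (1, m + 1))"
        unfolding base using i ni m by (intro clique_comp_base) auto
      moreover have "x = i" "y = i + m"
        using base i m k \<open>x = outer_pos _ _ a\<close> \<open>y = outer_pos _ _ b\<close>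
        by (auto simp: outer_pos_def split: if_splits)
      then have "?R (x, y) = star (?pr (i, i + 1)) (q (1, m + 1))"
        using i ni m by (simp add: clique_comp_base)
      moreover have "?pr (i, i + 1) = p (i, i + 1)"
        using i ni k by (intro clique_comp_outer) (auto simp: outer_pos_def)
      ultimately show ?thesis using L by simp
    next
      case crossing
      have "?pq (a, b) = one"
        using crossing outer \<open>b \<le> n + m\<close> by (intro clique_comp_crossing) auto
      moreover have "?R (x, y) = one"
        using crossing outer i m k xy by (intro clique_comp_crossing) (auto simp: outer_pos_def)
      ultimately show ?thesis using L by simp
    qed
  next
    case (inner a b)
    have "?L (x, y) = r (a, b)"
      using inner jm by (intro clique_comp_inner) auto
    moreover have "?R (x, y) = ?pr (a + j - 1, b + j - 1)"
      using inner i m k by (intro clique_comp_outer) (auto simp: outer_pos_def)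
    moreover have "\<dots> = r (a, b)"
      using inner i j by (intro clique_comp_inner) auto
    ultimately show ?thesis by simp
  next
    case base
    have "?L (x, y) = star (?pq (j + m - 1, j + m - 1 + 1)) (r (1, k + 1))"
      unfolding base using jm k by (intro clique_comp_base) auto
    moreover have "?pq (j + m - 1, j + m - 1 + 1) = p (j, j + 1)"
      using i m by (intro clique_comp_outer) (auto simp: outer_pos_def)
    moreover have "?R (x, y) = ?pr (j, j + k)"
      unfolding base using i m k by (intro clique_comp_outer) (auto simp: outer_pos_def)
    moreover have "\<dots> = star (p (j, j + 1)) (r (1, k + 1))"
      using i j k by (intro clique_comp_base) auto
    ultimately show ?thesis by simp
  next
    case crossing
    have "?L (x, y) = one"
      using crossing xy y' by (intro clique_comp_crossing) auto
    moreover have "?R (x, y) = one"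
    \<comment> \<open>On the right, the arc either starts strictly inside the image of \<open>q\<close>, and so crosses the
      gluing arc of \<open>q\<close>, or comes from an arc of \<open>p \<circ>\<^sub>j r\<close> that crosses the gluing arc of \<open>r\<close>.\<close>
    proof (cases "i < x \<and> x < i + m")
      case True
      then show ?thesis
        using crossing i m k xy by (intro clique_comp_crossing) auto
    next
      case False
      let ?a = "if x \<le> i then x else x - m + 1"
      have "?R (x, y) = ?pr (?a, y - m + 1)"
        using crossing False i m k xy by (intro clique_comp_outer) (auto simp: outer_pos_def)
      also have "\<dots> = one"
        using crossing False i m k xy by (intro clique_comp_crossing) auto
      finally show ?thesis .
    qed
    ultimately show ?thesis by simp
  qed
  then show "?L z = ?R z" by (simp add: z)
qed

section \<open>Composition with the unit clique, and closure\<close>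

lemma cliques_extensional: "p \<in> cliques one n \<Longrightarrow> p \<in> extensional (arcs n)"
  by (auto simp: cliques_def unit_clique_def PiE_def split: if_splits)

lemma unit_clique_apply [simp]: "unit_clique one (Suc 0, Suc (Suc 0)) = one"
  by (simp add: unit_clique_def arcs_def)

lemma clique_comp_unit_left:
  assumes "1 \<le> n" "q \<in> extensional (arcs n)" "unitary_magma star one"
  shows "clique_comp star one 1 n 1 (unit_clique one) q = q"
proof (rule extensionalityI[where A = "arcs n"])
  show "clique_comp star one 1 n 1 (unit_clique one) q \<in> extensional (arcs n)"
    using clique_comp_extensional[of star one 1 n] by simp
  fix z assume "z \<in> arcs n"
  then obtain x y where z: "z = (x, y)" and xy: "1 \<le> x" "x < y" "y \<le> n + 1"
    by (auto simp: arcs_def)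
  show "clique_comp star one 1 n 1 (unit_clique one) q z = q z"
  proof (cases "(x, y) = (1, n + 1)")
    case True
    then show ?thesis
      using assms clique_comp_base[of 1 1 n "n + 1" star one "unit_clique one" q]
      by (simp add: z unitary_magma.one_left)
  next
    case False
    then show ?thesis
      unfolding z using xy by (intro clique_comp_inner) auto
  qed
qed (fact assms)

lemma clique_comp_unit_right:
  assumes "1 \<le> i" "i \<le> n" "p \<in> extensional (arcs n)" "unitary_magma star one"
  shows "clique_comp star one n 1 i p (unit_clique one) = p"
proof (rule extensionalityI[where A = "arcs n"])
  show "clique_comp star one n 1 i p (unit_clique one) \<in> extensional (arcs n)"
    using clique_comp_extensional[of star one n 1] by simp
  fix z assume "z \<in> arcs n"
  then obtain x y where z: "z = (x, y)" and xy: "1 \<le> x" "x < y" "y \<le> n + 1"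
    by (auto simp: arcs_def)
  show "clique_comp star one n 1 i p (unit_clique one) z = p z"
  proof (cases "(x, y) = (i, i + 1)")
    case True
    then show ?thesis
      using assms clique_comp_base[of i n 1 "i + 1" star one p "unit_clique one"]
      by (simp add: z unitary_magma.one_right)
  next
    case False
    then show ?thesis
      unfolding z using xy by (intro clique_comp_outer) (auto simp: outer_pos_def)
  qed
qed (fact assms)

text \<open>The case of arity 1 is special because the only clique of arity 1 is the unit clique.\<close>

lemma clique_comp_closed:
  assumes "unitary_magma star one" "1 \<le> n" "1 \<le> m" "i \<in> {1..n}" "p \<in> cliques one n" "q \<in> cliques one m"
  shows "clique_comp star one n m i p q \<in> cliques one (n + m - 1)"
proof (cases "n + m - 1 = 1")
  case True
  then have [simp]: "n = 1" "m = 1" "i = 1" using assms(2-4) by auto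
  have [simp]: "p = unit_clique one" "q = unit_clique one"
    using assms(5,6) by (auto simp: cliques_def)
  show ?thesis
    using clique_comp_unit_left[of 1 "unit_clique one" star one] assms(1)
    by (simp add: cliques_def unit_clique_def)
next
  case False
  then show ?thesis
    using clique_comp_extensional[of star one n m i p q] by (simp add: cliques_def PiE_def)
qed

section \<open>Cycles in a composition\<close>

text \<open>An increasing map \<open>f\<close> of vertices that preserves solid arcs carries cycles of the skeleton to
  cycles.\<close>

lemma not_acyclic_clique_embed:
  assumes "1 \<le> n"
    and mono: "\<And>a b. 1 \<le> a \<Longrightarrow> a < b \<Longrightarrow> b \<le> n + 1 \<Longrightarrow> 1 \<le> f a \<and> f a < f b \<and> f b \<le> N + 1"
    and solid: "\<And>a b. 1 \<le> a \<Longrightarrow> a < b \<Longrightarrow> b \<le> n + 1 \<Longrightarrow> p (a, b) \<noteq> one \<Longrightarrow> s (f a, f b) \<noteq> one"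
    and "\<not> acyclic_clique one n p"
  shows "\<not> acyclic_clique one N s"
proof -
  obtain vs where vs: "set vs \<subseteq> fst (skeleton one n p)" "3 \<le> length vs" "distinct vs"
    and edge: "\<And>j. j < length vs \<Longrightarrow> {vs ! j, vs ! (Suc j mod length vs)} \<in> snd (skeleton one n p)"
    using assms(4) unfolding acyclic_clique_def is_graph_cycle_def
    by blast
  have vertices: "fst (skeleton one n p) = {1..n + 1}"
    by (simp add: skeleton_def)
  have range: "f a \<in> {1..N + 1}" if "a \<in> {1..n + 1}" for a
    using mono[of 1 "n + 1"] mono[of 1 a] mono[of a "n + 1"] that \<open>1 \<le> n\<close>
    by (cases "a = 1"; cases "a = n + 1") auto
  have inj: "inj_on f {1..n + 1}"
    using mono by (intro linorder_inj_onI) fastforce+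
  have image: "f ` e \<in> snd (skeleton one N s)" if e_edge: "e \<in> snd (skeleton one n p)" for e
  proof -
    obtain a b where e: "e = {a, b}" and "(a, b) \<in> arcs n" and solid_ab: "p (a, b) \<noteq> one"
      using e_edge unfolding skeleton_def snd_conv by blast
    then have ab: "1 \<le> a" "a < b" "b \<le> n + 1" by (auto simp: arcs_def)
    have "(f a, f b) \<in> arcs N" "s (f a, f b) \<noteq> one"
      using mono[OF ab] solid[OF ab solid_ab] by (auto simp: arcs_def)
    then show ?thesis by (auto simp: e skeleton_def)
  qed
  have "is_graph_cycle (skeleton one N s) (map f vs)"
    unfolding is_graph_cycle_def
  proof (intro conjI allI impI)
    show "set (map f vs) \<subseteq> fst (skeleton one N s)"
      using vs(1) vertices range by (auto simp: skeleton_def)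
    show "3 \<le> length (map f vs)" using vs(2) by simp
    show "distinct (map f vs)"
      using vs vertices inj by (auto simp: distinct_map intro: inj_on_subset)
    fix j assume "j < length (map f vs)"
    then have "Suc j mod length vs < length vs" by (intro mod_less_divisor) auto
    with \<open>j < length (map f vs)\<close> show "{map f vs ! j, map f vs ! (Suc j mod length (map f vs))} \<in> snd (skeleton one N s)"
      using image[OF edge[of j]] nth_map[of "Suc j mod length vs" vs f] by simp
  qed
  then show ?thesis by (auto simp: acyclic_clique_def)
qed

lemma not_acyclic_clique_comp_left:
  assumes units: "no_nontrivial_unit_divisors star one"
    and "1 \<le> i" "i \<le> n" "1 \<le> m" "\<not> acyclic_clique one n p"
  shows "\<not> acyclic_clique one (n + m - 1) (clique_comp star one n m i p q)"
proof (rule not_acyclic_clique_embed)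
  show "1 \<le> n" using assms by simp
  show "\<not> acyclic_clique one n p" by fact
  fix a b assume ab: "1 \<le> a" "a < b" "b \<le> n + 1"
  show "1 \<le> outer_pos i m a \<and> outer_pos i m a < outer_pos i m b \<and> outer_pos i m b \<le> n + m - 1 + 1"
    using ab assms(2-4) by (auto simp: outer_pos_def)
  assume solid: "p (a, b) \<noteq> one"
  show "clique_comp star one n m i p q (outer_pos i m a, outer_pos i m b) \<noteq> one"
  proof (cases "(a, b) = (i, i + 1)")
    case True
    then have "clique_comp star one n m i p q (outer_pos i m a, outer_pos i m b)
        = star (p (a, b)) (q (1, m + 1))"
      using assms(2-4) clique_comp_base[of i n m "i + m" star one p q] by (simp add: outer_pos_def)
    then show ?thesis using units solid unfolding no_nontrivial_unit_divisors_def by metis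
  next
    case False
    then show ?thesis using clique_comp_outer[of m a b n i _ _ star one p q] ab assms(4) solid by simp
  qed
qed

lemma not_acyclic_clique_comp_right:
  assumes units: "no_nontrivial_unit_divisors star one"
    and "1 \<le> i" "i \<le> n" "1 \<le> m" "\<not> acyclic_clique one m q"
  shows "\<not> acyclic_clique one (n + m - 1) (clique_comp star one n m i p q)"
proof (rule not_acyclic_clique_embed)
  show "1 \<le> m" by fact
  show "\<not> acyclic_clique one m q" by fact
  fix a b assume ab: "1 \<le> a" "a < b" "b \<le> m + 1"
  show "1 \<le> a + i - 1 \<and> a + i - 1 < b + i - 1 \<and> b + i - 1 \<le> n + m - 1 + 1"
    using ab assms(2-4) by auto
  assume solid: "q (a, b) \<noteq> one"
  show "clique_comp star one n m i p q (a + i - 1, b + i - 1) \<noteq> one"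
  proof (cases "(a, b) = (1, m + 1)")
    case True
    then have "clique_comp star one n m i p q (a + i - 1, b + i - 1)
        = star (p (i, i + 1)) (q (a, b))"
      using assms(2-4) clique_comp_base[of i n m "i + m" star one p q] by (simp add: add.commute)
    then show ?thesis using units solid unfolding no_nontrivial_unit_divisors_def by metis
  next
    case False
    then show ?thesis
      using clique_comp_inner[of i n a b m _ _ star one p q] ab assms(2,3) solid by simp
  qed
qed

section \<open>Linear combinations\<close>

lemma lookup_lc_scale [simp]:
  "Poly_Mapping.lookup (lc_scale c v) x = c * Poly_Mapping.lookup v x"
  by (auto simp: lc_scale_def Poly_Mapping.map.rep_eq when_def)

lemma vector_space_lc_scale: "vector_space lc_scale"
  by unfold_locales (auto intro!: poly_mapping_eqI simp: lookup_add algebra_simps)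

lemma keys_lc_scale: "Poly_Mapping.keys (lc_scale c v) \<subseteq> Poly_Mapping.keys v"
  by (auto simp: in_keys_iff)

lemma lc_scale_single: "lc_scale c (Poly_Mapping.single x a) = Poly_Mapping.single x (c * a)"
  by (auto intro!: poly_mapping_eqI simp: lookup_single when_def)

lemma sum_single_lookup:
  "(\<Sum>x\<in>Poly_Mapping.keys v. Poly_Mapping.single x (Poly_Mapping.lookup v x)) = v"
  by (rule poly_mapping_eqI)
    (auto simp: lookup_sum lookup_single when_def in_keys_iff)

lemma subspace_keys: "module.subspace lc_scale {v. Poly_Mapping.keys v \<subseteq> B}"
proof -
  interpret vector_space lc_scale by (rule vector_space_lc_scale)
  show ?thesis
  proof (rule subspaceI, goal_cases)
    case (2 v w)
    then show ?case using keys_add[of v w] by blast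
  next
    case (3 c v)
    then show ?case using keys_lc_scale[of c v] by blast
  qed simp
qed

lemma span_single_eq:
  "module.span lc_scale ((\<lambda>x. Poly_Mapping.single x (1::'k::field)) ` B)
    = {v. Poly_Mapping.keys v \<subseteq> B}"
proof -
  interpret vector_space "lc_scale :: 'k \<Rightarrow> ('a \<Rightarrow>\<^sub>0 'k) \<Rightarrow> _" by (rule vector_space_lc_scale)
  show ?thesis
  proof (rule span_unique)
    fix T assume T: "(\<lambda>x. Poly_Mapping.single x 1) ` B \<subseteq> T" "subspace T"
    show "{v. Poly_Mapping.keys v \<subseteq> B} \<subseteq> T"
    proof clarify
      fix v :: "'a \<Rightarrow>\<^sub>0 'k" assume v: "Poly_Mapping.keys v \<subseteq> B"
      have "(\<Sum>x\<in>Poly_Mapping.keys v. lc_scale (Poly_Mapping.lookup v x) (Poly_Mapping.single x 1)) \<in> T"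
        using v T by (intro subspace_sum subspace_scale) auto
      then show "v \<in> T" by (simp add: lc_scale_single sum_single_lookup)
    qed
  qed (auto simp: subspace_keys)
qed

section \<open>Bilinear extension of the composition\<close>

text \<open>Enlarging the index sets to common supersets of the supports makes sums of compositions
  comparable term by term.\<close>

lemma C_comp_eq_sum_superset:
  assumes "finite A" "Poly_Mapping.keys v \<subseteq> A" "finite B" "Poly_Mapping.keys w \<subseteq> B"
  shows "C_comp star one n m i v w =
    (\<Sum>p\<in>A. \<Sum>q\<in>B. Poly_Mapping.single (clique_comp star one n m i p q)
      (Poly_Mapping.lookup v p * Poly_Mapping.lookup w q))"
proof -
  have "C_comp star one n m i v w = (\<Sum>p\<in>Poly_Mapping.keys v. \<Sum>q\<in>B.
      Poly_Mapping.single (clique_comp star one n m i p q)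
        (Poly_Mapping.lookup v p * Poly_Mapping.lookup w q))"
    unfolding C_comp_def using assms
    by (intro sum.cong sum.mono_neutral_left) (auto simp: in_keys_iff)
  also have "\<dots> = (\<Sum>p\<in>A. \<Sum>q\<in>B. Poly_Mapping.single (clique_comp star one n m i p q)
      (Poly_Mapping.lookup v p * Poly_Mapping.lookup w q))"
    using assms by (intro sum.mono_neutral_left) (auto simp: in_keys_iff)
  finally show ?thesis .
qed

lemma C_comp_add_left:
  "C_comp star one n m i (v + v') w = C_comp star one n m i v w + C_comp star one n m i v' w"
proof -
  let ?A = "Poly_Mapping.keys v \<union> Poly_Mapping.keys v'" and ?B = "Poly_Mapping.keys w"
  have "Poly_Mapping.keys (v + v') \<subseteq> ?A" by (rule keys_add)
  then show ?thesis
    by (simp add: C_comp_eq_sum_superset[of ?A _ ?B] lookup_add algebra_simps single_add sum.distrib)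
qed

lemma C_comp_add_right:
  "C_comp star one n m i v (w + w') = C_comp star one n m i v w + C_comp star one n m i v w'"
proof -
  let ?A = "Poly_Mapping.keys v" and ?B = "Poly_Mapping.keys w \<union> Poly_Mapping.keys w'"
  have "Poly_Mapping.keys (w + w') \<subseteq> ?B" by (rule keys_add)
  then show ?thesis
    by (simp add: C_comp_eq_sum_superset[of ?A _ ?B] lookup_add algebra_simps single_add sum.distrib)
qed

lemma C_comp_scale_left:
  "C_comp star one n m i (lc_scale c v) w = lc_scale c (C_comp star one n m i v w)"
proof -
  interpret vector_space lc_scale by (rule vector_space_lc_scale)
  show ?thesis
    using keys_lc_scale[of c v]
    by (simp add: C_comp_eq_sum_superset[of "Poly_Mapping.keys v" _ "Poly_Mapping.keys w"]
        scale_sum_right lc_scale_single mult_ac)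
qed

lemma C_comp_scale_right:
  "C_comp star one n m i v (lc_scale c w) = lc_scale c (C_comp star one n m i v w)"
proof -
  interpret vector_space lc_scale by (rule vector_space_lc_scale)
  show ?thesis
    using keys_lc_scale[of c w]
    by (simp add: C_comp_eq_sum_superset[of "Poly_Mapping.keys v" _ "Poly_Mapping.keys w"]
        scale_sum_right lc_scale_single mult_ac)
qed

lemma C_comp_single:
  "C_comp star one n m i (Poly_Mapping.single p a) (Poly_Mapping.single q b)
    = Poly_Mapping.single (clique_comp star one n m i p q) (a * b)"
  by (simp add: C_comp_eq_sum_superset[of "{p}" _ "{q}"])

lemma keys_C_comp:
  "Poly_Mapping.keys (C_comp star one n m i v w) \<subseteq>
    {clique_comp star one n m i p q | p q. p \<in> Poly_Mapping.keys v \<and> q \<in> Poly_Mapping.keys w}"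
proof
  fix s assume s: "s \<in> Poly_Mapping.keys (C_comp star one n m i v w)"
  let ?t = "\<lambda>p q. Poly_Mapping.single (clique_comp star one n m i p q)
      (Poly_Mapping.lookup v p * Poly_Mapping.lookup w q)"
  obtain p where p: "p \<in> Poly_Mapping.keys v"
    and "s \<in> Poly_Mapping.keys (\<Sum>q\<in>Poly_Mapping.keys w. ?t p q)"
    using s keys_sum unfolding C_comp_def by fastforce
  then obtain q where "q \<in> Poly_Mapping.keys w" "s \<in> Poly_Mapping.keys (?t p q)"
    using keys_sum by fastforce
  with p show "s \<in> {clique_comp star one n m i p q | p q.
      p \<in> Poly_Mapping.keys v \<and> q \<in> Poly_Mapping.keys w}"
    by (auto split: if_splits)
qed

text \<open>An additive statement on the space of cliques of arity \<open>n\<close> need only be checked on multiples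
  of basis vectors.\<close>

lemma C_space_induct [consumes 1, case_names zero single add]:
  assumes "v \<in> C_space one n"
    and "P 0"
    and "\<And>p a. p \<in> cliques one n \<Longrightarrow> P (Poly_Mapping.single p a)"
    and "\<And>v w. P v \<Longrightarrow> P w \<Longrightarrow> P (v + w)"
  shows "P v"
proof -
  have "P (\<Sum>p\<in>A. Poly_Mapping.single p (Poly_Mapping.lookup v p))"
    if "finite A" "A \<subseteq> cliques one n" for A
    using that by induction (auto intro: assms)
  from this[of "Poly_Mapping.keys v"] show ?thesis
    using assms(1) by (simp add: C_space_def sum_single_lookup)
qed

lemma C_comp_zero [simp]: "C_comp star one n m i 0 w = 0" "C_comp star one n m i v 0 = 0"
  by (simp_all add: C_comp_def)

section \<open>The operad of cliques\<close>

lemma C_comp_sequential: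
  fixes u v w :: "'m clique \<Rightarrow>\<^sub>0 'k::field"
  assumes "unitary_magma star one"
    and "1 \<le> n" "1 \<le> m" "1 \<le> k" "i \<in> {1..n}" "j \<in> {1..m}"
    and u: "u \<in> C_space one n" and v: "v \<in> C_space one m" and w: "w \<in> C_space one k"
  shows "C_comp star one (n + m - 1) k (i + j - 1) (C_comp star one n m i u v) w
    = C_comp star one n (m + k - 1) i u (C_comp star one m k j v w)"
proof -
  interpret unitary_magma star one by fact
  have basis: "clique_comp star one (n + m - 1) k (i + j - 1) (clique_comp star one n m i p q) r
      = clique_comp star one n (m + k - 1) i p (clique_comp star one m k j q r)"
    if "q \<in> cliques one m" for p q r
  proof (rule clique_comp_sequential)
    assume "m = 1"
    \<comment> \<open>The only clique of arity 1 is the unit clique.\<close>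
    then have "q (1, 2) = one" using that by (simp add: cliques_def numeral_2_eq_2)
    then show "star (star (p (i, i + 1)) (q (1, 2))) (r (1, k + 1))
        = star (p (i, i + 1)) (star (q (1, 2)) (r (1, k + 1)))"
      by (simp add: one_left one_right)
  qed (use assms in auto)
  from u show ?thesis
  proof (induction rule: C_space_induct)
    case (single p a)
    from v show ?case
    proof (induction rule: C_space_induct)
      case (single q b)
      from w show ?case
        by (induction rule: C_space_induct)
          (use single in \<open>simp_all add: C_comp_single C_comp_add_right basis mult.assoc del: One_nat_def\<close>)
    qed (simp_all add: C_comp_add_left C_comp_add_right)
  qed (simp_all add: C_comp_add_left)
qed

lemma C_comp_parallel:
  fixes u v w :: "'m clique \<Rightarrow>\<^sub>0 'k::field"
  assumes "1 \<le> n" "1 \<le> m" "1 \<le> k" "i \<in> {1..n}" "j \<in> {1..n}" "i < j"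
    and u: "u \<in> C_space one n" and v: "v \<in> C_space one m" and w: "w \<in> C_space one k"
  shows "C_comp star one (n + m - 1) k (j + m - 1) (C_comp star one n m i u v) w
    = C_comp star one (n + k - 1) m i (C_comp star one n k j u w) v"
proof -
  have basis: "clique_comp star one (n + m - 1) k (j + m - 1) (clique_comp star one n m i p q) r
      = clique_comp star one (n + k - 1) m i (clique_comp star one n k j p r) q" for p q r
    using assms by (intro clique_comp_parallel) auto
  from u show ?thesis
  proof (induction rule: C_space_induct)
    case (single p a)
    from v show ?case
    proof (induction rule: C_space_induct)
      case (single q b)
      from w show ?case
        by (induction rule: C_space_induct)
          (simp_all add: C_comp_single C_comp_add_left C_comp_add_right basis mult_ac del: One_nat_def)
    qed (simp_all add: C_comp_add_left C_comp_add_right)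
  qed (simp_all add: C_comp_add_left)
qed

text \<open>The cliques labelled by an arbitrary unitary magma form an operad.\<close>

theorem ns_operad_C:
  assumes "unitary_magma star one"
  shows "ns_operad (lc_scale :: 'k::field \<Rightarrow> ('m clique \<Rightarrow>\<^sub>0 'k) \<Rightarrow> ('m clique \<Rightarrow>\<^sub>0 'k))
    (C_space one) (C_comp star one) (C_unit one)"
proof -
  interpret unitary_magma star one by fact
  interpret vector_space "lc_scale :: 'k \<Rightarrow> ('m clique \<Rightarrow>\<^sub>0 'k) \<Rightarrow> _" by (rule vector_space_lc_scale)
  show ?thesis
  proof (unfold_locales, goal_cases)
    case (1 n)
    show ?case unfolding C_space_def by (rule subspace_keys)
  next
    case 2
    show ?case by (simp add: C_space_def C_unit_def cliques_def)
  next
    case (3 n m i x y)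
    then show ?case
      using keys_C_comp[of star one n m i x y] clique_comp_closed[OF assms(1), of n m i]
      unfolding C_space_def by blast
  next
    case (4 n m i x x' y)
    show ?case by (rule C_comp_add_left)
  next
    case (5 n m i x y y')
    show ?case by (rule C_comp_add_right)
  next
    case (6 n m i x y c)
    show ?case by (rule C_comp_scale_left)
  next
    case (7 n m i x y c)
    show ?case by (rule C_comp_scale_right)
  next
    case (8 n m k i j x y z)
    then show ?case by (intro C_comp_sequential assms)
  next
    case (9 n m k i j x y z)
    then show ?case by (intro C_comp_parallel)
  next
    case (10 n x)
    from 10(2) show ?case unfolding C_unit_def
      by (induction rule: C_space_induct)
        (use 10(1) in \<open>simp_all add: C_comp_add_right C_comp_single
          clique_comp_unit_left[OF _ _ assms, simplified] cliques_extensional\<close>)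
  next
    case (11 n i x)
    from 11(3) show ?case unfolding C_unit_def
      by (induction rule: C_space_induct)
        (use 11(1,2) in \<open>simp_all add: C_comp_add_left C_comp_single
          clique_comp_unit_right[OF _ _ _ assms, simplified] cliques_extensional\<close>)
  qed
qed

section \<open>The ideal of cliques with a cycle\<close>

lemma R_Acy_eq:
  "R_Acy one n = {v. Poly_Mapping.keys v \<subseteq> {p \<in> cliques one n. \<not> acyclic_clique one n p}}"
  unfolding R_Acy_def by (rule span_single_eq)

theorem proposition3p1p9:
  fixes star :: "'m \<Rightarrow> 'm \<Rightarrow> 'm" and one :: 'm
  assumes "unitary_magma star one"
    and "no_nontrivial_unit_divisors star one"
  shows "operad_ideal (lc_scale :: 'k::field_char_0 \<Rightarrow> ('m clique \<Rightarrow>\<^sub>0 'k) \<Rightarrow> ('m clique \<Rightarrow>\<^sub>0 'k))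
    (C_space one) (C_comp star one) (C_unit one) (R_Acy one)"
proof -
  interpret ns_operad "lc_scale :: 'k \<Rightarrow> ('m clique \<Rightarrow>\<^sub>0 'k) \<Rightarrow> _"
    "C_space one" "C_comp star one" "C_unit one"
    by (rule ns_operad_C) (fact assms(1))
  show ?thesis
  proof (unfold_locales, goal_cases)
    case (1 n)
    show ?case unfolding R_Acy_eq by (rule subspace_keys)
  next
    case (2 n)
    show ?case by (auto simp: R_Acy_eq C_space_def)
  next
    case (3 n m i x y)
    then show ?case
      using keys_C_comp[of star one n m i x y] clique_comp_closed[OF assms(1), of n m i]
        not_acyclic_clique_comp_right[OF assms(2), of i n m]
      unfolding C_space_def R_Acy_eq atLeastAtMost_iff by blast
  next
    case (4 n m j x y)
    then show ?case
      using keys_C_comp[of star one m n j y x] clique_comp_closed[OF assms(1), of m n j]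
        not_acyclic_clique_comp_left[OF assms(2), of j m n]
      unfolding C_space_def R_Acy_eq atLeastAtMost_iff add.commute[of n m] by blast
  qed
qed

end
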